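(* Let $G=(V,E)$ be a connected graph with $a(G)=k\ge2$. Let $E_k(G)$ be the set of edges $e=(v_1,v_2)$, with $v_1,v_2\in V$ distinct, that can be added to $G$ such that $a(G+e)=k$. Let $D(G)$ be the fractional arboricity of $G$. Each of the following holds: (i) If $D(G)<k$, then $E_k(G)=\{e=(v_1,v_2):v_1,v_2\in V,\ v_1\neq v_2\}$. (ii) If $D(G)=k$ and $G$ is homogeneous, then $E_k(G)=\emptyset$. (iii) If $D(G)=k$ and $G$ is not homogeneous, then $E_k(G)$ is the set of edges $e=(v_1,v_2)$, $v_1\ne v_2$, such that $v_1,v_2$ do not belong to any common connected vertex-induced subgraph of $G$ optimizing $D(G)$.
   Context: Graphs are finite and undirected, without self-loops, possibly with parallel edges; the added edge $e$ may be parallel to an existing edge of $G$. $G+e$ denotes $G$ with the new edge $e$ added. The arboricity $a(G)$ of a connected graph is the minimum number of spanning trees whose union is the edge set of $G$. Let $r$ be the rank function of the graphic matroid of $G$ (on ground set $E$). The fractional arboricity is $D(G)=\max\{|X|/r(X):X\subseteq E,\ r(X)>0\}$; a subgraph $K$ optimizes $D(G)$ if its edge set attains this maximum, i.e. $r(E(K))>0$ and $|E(K)|/r(E(K))=D(G)$. $G$ is homogeneous if its graphic matroid is: the unique minimizer of $\sum_{e\in E}\eta(e)^2$ over the convex hull of the indicator vectors of the spanning trees is a constant vector (equivalently, $D(G)=|E|/r(E)$). *)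

theory Defs
  imports "HOL-Analysis.Analysis" "HOL-Library.Function_Algebras"
begin

section \<open>Undirected multigraphs\<close>

text \<open>Edges are named objects and \<open>ends\<close> maps an edge to its set of two end vertices, so
  different edges may be parallel.  The value of \<open>ends\<close> outside \<open>edges\<close> is irrelevant.\<close>

record ('v, 'e) mgraph =
  verts :: "'v set"
  edges :: "'e set"
  ends :: "'e \<Rightarrow> 'v set"

locale multigraph =
  fixes G :: "('v, 'e) mgraph"
  assumes finite_verts: "finite (verts G)"
    and finite_edges: "finite (edges G)"
    and ends_edge: "e \<in> edges G \<Longrightarrow> \<exists>u\<in>verts G. \<exists>v\<in>verts G. u \<noteq> v \<and> ends G e = {u, v}"

definition adjacent :: "('v, 'e) mgraph \<Rightarrow> ('v \<times> 'v) set" where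
  "adjacent G = {(u, v). \<exists>e\<in>edges G. ends G e = {u, v}}"

definition connected_graph :: "('v, 'e) mgraph \<Rightarrow> bool" where
  "connected_graph G \<longleftrightarrow>
     verts G \<noteq> {} \<and> (\<forall>u\<in>verts G. \<forall>v\<in>verts G. (u, v) \<in> (adjacent G)\<^sup>*)"

text \<open>The edge \<open>es ! i\<close> joins the vertex \<open>vs ! i\<close> to its cyclic successor.  Cycles of length 2,
  consisting of two parallel edges, are included.\<close>

definition is_cycle :: "('v, 'e) mgraph \<Rightarrow> 'v list \<Rightarrow> 'e list \<Rightarrow> bool" where
  "is_cycle G vs es \<longleftrightarrow>
     2 \<le> length vs \<and> length es = length vs \<and> distinct vs \<and> distinct es \<and> set es \<subseteq> edges G \<and>
     (\<forall>i<length vs. ends G (es ! i) = {vs ! i, vs ! (Suc i mod length vs)})"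

definition acyclic_edges :: "('v, 'e) mgraph \<Rightarrow> 'e set \<Rightarrow> bool" where
  "acyclic_edges G F \<longleftrightarrow> \<not> (\<exists>vs es. is_cycle G vs es \<and> set es \<subseteq> F)"

definition spanning_trees :: "('v, 'e) mgraph \<Rightarrow> 'e set set" where
  "spanning_trees G =
     {T. T \<subseteq> edges G \<and> connected_graph (G\<lparr>edges := T\<rparr>) \<and> acyclic_edges G T}"

text \<open>The type of the edge names is extended by \<open>None\<close>, which serves as the name of the new edge;
  in this way a fresh name is available even if \<open>edges G\<close> is the whole type.\<close>

definition add_edge :: "('v, 'e) mgraph \<Rightarrow> 'v \<Rightarrow> 'v \<Rightarrow> ('v, 'e option) mgraph" where
  "add_edge G u v =
     \<lparr>verts = verts G, edges = insert None (Some ` edges G),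
      ends = (\<lambda>x. case x of None \<Rightarrow> {u, v} | Some e \<Rightarrow> ends G e)\<rparr>"

definition induced_subgraph :: "('v, 'e) mgraph \<Rightarrow> 'v set \<Rightarrow> ('v, 'e) mgraph" where
  "induced_subgraph G W = G\<lparr>verts := W, edges := {e \<in> edges G. ends G e \<subseteq> W}\<rparr>"


section \<open>Arboricity and fractional arboricity\<close>

definition arboricity :: "('v, 'e) mgraph \<Rightarrow> nat" where
  "arboricity G =
     (LEAST n. \<exists>\<T>. finite \<T> \<and> card \<T> = n \<and> \<T> \<subseteq> spanning_trees G \<and> \<Union>\<T> = edges G)"

definition graphic_rank :: "('v, 'e) mgraph \<Rightarrow> 'e set \<Rightarrow> nat" where
  "graphic_rank G X = Max (card ` {F. F \<subseteq> X \<and> acyclic_edges G F})"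

definition fractional_arboricity :: "('v, 'e) mgraph \<Rightarrow> real" where
  "fractional_arboricity G =
     Max {real (card X) / real (graphic_rank G X) | X. X \<subseteq> edges G \<and> graphic_rank G X > 0}"

text \<open>\<open>K\<close> is meant to be a subgraph of \<open>G\<close>.\<close>

definition optimizes :: "('v, 'e) mgraph \<Rightarrow> ('v, 'e) mgraph \<Rightarrow> bool" where
  "optimizes G K \<longleftrightarrow>
     graphic_rank G (edges K) > 0 \<and>
     real (card (edges K)) / real (graphic_rank G (edges K)) = fractional_arboricity G"


section \<open>Homogeneous graphs\<close>

text \<open>The pointwise vector space structure on functions, which makes \<^const>\<open>convex\<close> and
  \<open>convex hull\<close> available for vectors indexed by edges.\<close>

instantiation "fun" :: (type, real_vector) real_vector
begin

definition scaleR_fun :: "real \<Rightarrow> ('a \<Rightarrow> 'b) \<Rightarrow> 'a \<Rightarrow> 'b" where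
  "scaleR_fun r f = (\<lambda>x. r *\<^sub>R f x)"

instance
  by standard (auto simp: scaleR_fun_def fun_eq_iff scaleR_add_right scaleR_add_left)

end

lemma scaleR_fun_apply [simp]: "(r *\<^sub>R f) x = r *\<^sub>R f x"
  by (simp add: scaleR_fun_def)

text \<open>Vectors indexed by the edges are functions on the whole type of edge names; those in the
  following polytope vanish outside \<open>edges G\<close>.\<close>

definition spanning_tree_polytope :: "('v, 'e) mgraph \<Rightarrow> ('e \<Rightarrow> real) set" where
  "spanning_tree_polytope G = convex hull (indicat_real ` spanning_trees G)"

definition min_norm_vector :: "('v, 'e) mgraph \<Rightarrow> ('e \<Rightarrow> real) \<Rightarrow> bool" where
  "min_norm_vector G \<eta> \<longleftrightarrow>
     is_arg_min (\<lambda>\<eta>. \<Sum>e\<in>edges G. (\<eta> e)\<^sup>2) (\<lambda>\<eta>. \<eta> \<in> spanning_tree_polytope G) \<eta>"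

lemma spanning_tree_polytope_outside:
  assumes "\<eta> \<in> spanning_tree_polytope G" "e \<notin> edges G"
  shows "\<eta> e = 0"
proof -
  have "spanning_tree_polytope G \<subseteq> {\<eta>. \<eta> e = 0}"
    unfolding spanning_tree_polytope_def
  proof (rule hull_minimal)
    show "indicat_real ` spanning_trees G \<subseteq> {\<eta>. \<eta> e = 0}"
      using assms(2) by (auto simp: spanning_trees_def indicator_def)
    show "convex {\<eta>. (\<eta> e :: real) = 0}"
      by (auto simp: convex_def)
  qed
  with assms(1) show ?thesis by blast
qed

lemma min_norm_vector_unique:
  assumes "finite (edges G)" "min_norm_vector G \<eta>" "min_norm_vector G \<zeta>"
  shows "\<eta> = \<zeta>"
proof -
  let ?f = "\<lambda>\<eta>. \<Sum>e\<in>edges G. (\<eta> e :: real)\<^sup>2"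
  let ?m = "(1/2) *\<^sub>R \<eta> + (1/2) *\<^sub>R \<zeta>"
  have mem: "\<eta> \<in> spanning_tree_polytope G" "\<zeta> \<in> spanning_tree_polytope G"
    and min: "\<And>y. y \<in> spanning_tree_polytope G \<Longrightarrow> ?f \<eta> \<le> ?f y"
             "\<And>y. y \<in> spanning_tree_polytope G \<Longrightarrow> ?f \<zeta> \<le> ?f y"
    using assms by (auto simp: min_norm_vector_def is_arg_min_linorder)
  have "convex (spanning_tree_polytope G)"
    by (simp add: spanning_tree_polytope_def)
  then have "?m \<in> spanning_tree_polytope G"
    using mem by (intro convexD) auto
  then have "?f \<eta> + ?f \<zeta> \<le> 2 * ?f ?m"
    using min(1)[of ?m] min(2)[of ?m] by linarith
  moreover have "2 * ?f ?m + (\<Sum>e\<in>edges G. (\<eta> e - \<zeta> e)\<^sup>2 / 2) = ?f \<eta> + ?f \<zeta>"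
    unfolding sum_distrib_left sum.distrib[symmetric]
    by (rule sum.cong) (auto simp: power2_eq_square field_simps)
  ultimately have "(\<Sum>e\<in>edges G. (\<eta> e - \<zeta> e)\<^sup>2 / 2) \<le> 0" by linarith
  then have "(\<Sum>e\<in>edges G. (\<eta> e - \<zeta> e)\<^sup>2 / 2) = 0"
    by (intro antisym sum_nonneg) auto
  then have "\<And>e. e \<in> edges G \<Longrightarrow> \<eta> e = \<zeta> e"
    using assms(1) by (subst (asm) sum_nonneg_eq_0_iff) auto
  then show ?thesis
    using mem spanning_tree_polytope_outside by (metis ext)
qed

text \<open>There is at most one \<open>min_norm_vector\<close> by the preceding lemma.\<close>

definition homogeneous :: "('v, 'e) mgraph \<Rightarrow> bool" where
  "homogeneous G \<longleftrightarrow> (\<exists>\<eta> c. min_norm_vector G \<eta> \<and> (\<forall>e\<in>edges G. \<eta> e = c))"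


section \<open>Edges whose addition keeps the arboricity\<close>

text \<open>A candidate edge is identified with the unordered pair of its ends.\<close>

definition addable_edges :: "nat \<Rightarrow> ('v, 'e) mgraph \<Rightarrow> 'v set set" where
  "addable_edges k G =
     {{v\<^sub>1, v\<^sub>2} | v\<^sub>1 v\<^sub>2.
        v\<^sub>1 \<in> verts G \<and> v\<^sub>2 \<in> verts G \<and> v\<^sub>1 \<noteq> v\<^sub>2 \<and> arboricity (add_edge G v\<^sub>1 v\<^sub>2) = k}"

end

theory Submission
  imports Defs
begin

text \<open>All three parts follow from one criterion, \<open>arboricity_add_edge_eq_iff\<close>: adding an edge \<open>uv\<close>
  to a connected graph \<open>G\<close> of arboricity \<open>k\<close> raises the arboricity if and only if \<open>u\<close> and \<open>v\<close> lie
  in a common connected induced subgraph \<open>K\<close> with \<open>|E(K)| = k r(E(K)) > 0\<close>.  Arboricity at most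
  \<open>k\<close> means that \<open>k\<close> forests cover the edges, because every forest extends to a spanning tree.

  Such a subgraph \<open>K\<close> clearly blocks \<open>uv\<close>: \<open>k\<close> forests contain at most \<open>k r\<close> edges of any set of
  rank \<open>r\<close>, and \<open>uv\<close> does not raise the rank of \<open>E(K)\<close>.  For the converse, cover \<open>G\<close> by \<open>k\<close>
  disjoint forests and try to accommodate \<open>uv\<close> by exchanges: put the spare edge into one of the
  forests and take out an edge of the cycle that it closes, which is then spare.  If no sequence
  of exchanges succeeds, the set \<open>Y\<close> of old edges that become spare is spanned, together with
  \<open>uv\<close>, by the part of each single forest in \<open>Y\<close>; this is \<open>partition_augmentation\<close>, which holds in
  every matroid.  The vertices that \<open>Y\<close> connects to \<open>u\<close> then induce the required \<open>K\<close>
  (\<open>blocked_by_tight_subgraph\<close>).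

  A subgraph with \<open>|E(K)| = k r(E(K)) > 0\<close> has density \<open>k\<close>.  If \<open>D(G) < k\<close> there is none, so nothing
  is blocked.  If \<open>D(G) = k\<close> these are precisely the subgraphs that optimize \<open>D(G)\<close>; and when \<open>G\<close>
  is homogeneous, \<open>G\<close> is one of them (\<open>homogeneous_densest\<close>) and blocks every pair.\<close>

section \<open>Matroids given by a closure operator\<close>

text \<open>A closure operator suits graphs better than independent sets as the primitive notion: an edge
  is in the closure of a set of edges if the set connects its ends, and idempotence and exchange
  become statements about paths.  The axiom \<open>cl_least\<close> combines monotonicity and idempotence.\<close>

locale closure_matroid =
  fixes E :: "'a set" and cl :: "'a set \<Rightarrow> 'a set"
  assumes finite_ground: "finite E"
    and cl_ground: "cl A \<subseteq> E"
    and extensive: "A \<subseteq> E \<Longrightarrow> A \<subseteq> cl A"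
    and cl_least: "A \<subseteq> cl B \<Longrightarrow> cl A \<subseteq> cl B"
    and exchange: "g \<in> E \<Longrightarrow> f \<in> cl (insert g A) \<Longrightarrow> f \<notin> cl A \<Longrightarrow> g \<in> cl (insert f A)"
begin

definition indep :: "'a set \<Rightarrow> bool" where
  "indep A \<longleftrightarrow> A \<subseteq> E \<and> (\<forall>a\<in>A. a \<notin> cl (A - {a}))"

lemma indep_ground: "indep A \<Longrightarrow> A \<subseteq> E"
  by (simp add: indep_def)

lemma indep_finite: "indep A \<Longrightarrow> finite A"
  using finite_ground finite_subset indep_ground by blast

lemma cl_mono: "A \<subseteq> B \<Longrightarrow> B \<subseteq> E \<Longrightarrow> cl A \<subseteq> cl B"
  by (rule cl_least) (use extensive in blast)

lemma indep_empty: "indep {}"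
  by (simp add: indep_def)

lemma indep_subset: "indep A \<Longrightarrow> B \<subseteq> A \<Longrightarrow> indep B"
  using cl_mono[of "B - {b}" "A - {b}" for b] unfolding indep_def by blast

lemma indep_insert:
  assumes "indep A" "f \<in> E" "f \<notin> cl A"
  shows "indep (insert f A)"
proof -
  have A: "A \<subseteq> E" using assms(1) by (rule indep_ground)
  then have f: "f \<notin> A" using assms(3) extensive by blast
  have "z \<notin> cl (insert f A - {z})" if z: "z \<in> A" for z
  proof
    assume "z \<in> cl (insert f A - {z})"
    moreover have "insert f A - {z} = insert f (A - {z})" using f z by blast
    moreover have "z \<notin> cl (A - {z})" using assms(1) z by (simp add: indep_def)
    ultimately have "f \<in> cl (insert z (A - {z}))" using exchange assms(2) by metis
    then show False using assms(3) z by (simp add: insert_absorb)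
  qed
  moreover have "insert f A - {f} = A" using f by blast
  ultimately show ?thesis using A assms(2,3) by (auto simp: indep_def)
qed

text \<open>The Steinitz bound, in the form in which it yields that all bases have the same size: the
  elements of \<open>I\<close> outside \<open>J\<close> are replaced one at a time by elements of \<open>J\<close>, keeping
  independence.\<close>

lemma card_indep_le:
  assumes "indep I" "I \<subseteq> cl J" "J \<subseteq> E"
  shows "card I \<le> card J"
  using assms(1,2)
proof (induction "card (I - J)" arbitrary: I rule: less_induct)
  case less
  have fin: "finite I" "finite J"
    using less.prems indep_finite assms(3) finite_ground finite_subset by blast+
  show ?case
  proof (cases "I \<subseteq> J")
    case True
    then show ?thesis using fin card_mono by blast
  next
    case False
    then obtain x where x: "x \<in> I" "x \<notin> J" by blast
    have I': "indep (I - {x})" using less.prems(1) indep_subset by blast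
    have "x \<notin> cl (I - {x})" using less.prems(1) x by (simp add: indep_def)
    then have "\<not> J \<subseteq> cl (I - {x})" using cl_least x less.prems(2) by blast
    then obtain y where y: "y \<in> J" "y \<notin> cl (I - {x})" by blast
    then have yI: "y \<notin> I - {x}" using extensive indep_ground[OF I'] by blast
    let ?I = "insert y (I - {x})"
    have "indep ?I" using indep_insert[OF I' _ y(2)] y(1) assms(3) by blast
    moreover have "?I \<subseteq> cl J" using less.prems(2) y(1) extensive[OF assms(3)] by blast
    moreover have "?I - J = I - J - {x}" using y(1) by auto
    then have "card (?I - J) < card (I - J)"
      using fin x card_Diff1_less[of "I - J" x] by simp
    ultimately have "card ?I \<le> card J" using less.hyps by blast
    moreover have "card ?I = card I"
      using fin x yI by (metis card_Suc_Diff1 card_insert_disjoint finite_Diff)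
    ultimately show ?thesis by simp
  qed
qed

lemma basis_extension:
  assumes "indep I" "I \<subseteq> X" "X \<subseteq> E"
  obtains B where "I \<subseteq> B" "B \<subseteq> X" "indep B" "X \<subseteq> cl B"
proof -
  define S where "S = {B. I \<subseteq> B \<and> B \<subseteq> X \<and> indep B}"
  have "S \<subseteq> Pow E" using assms(3) by (auto simp: S_def)
  then have "finite S" using finite_ground by (simp add: finite_subset)
  moreover have "I \<in> S" using assms by (simp add: S_def)
  ultimately obtain B where "B \<in> S" and max: "\<And>C. C \<in> S \<Longrightarrow> B \<subseteq> C \<Longrightarrow> B = C"
    using finite_has_maximal2[of S I] by metis
  then have B: "I \<subseteq> B" "B \<subseteq> X" "indep B" by (simp_all add: S_def)
  have "x \<in> cl B" if x: "x \<in> X" for x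
  proof (rule ccontr)
    assume "x \<notin> cl B"
    moreover from this have "x \<notin> B" using extensive B assms(3) by blast
    moreover have "indep (insert x B)"
      using calculation(1) indep_insert B x assms(3) by blast
    ultimately show False using max[of "insert x B"] B x by (auto simp: S_def)
  qed
  then show ?thesis using that B by blast
qed

text \<open>For \<open>f\<close> outside \<open>F\<close>, the set is the fundamental circuit of \<open>f\<close> with respect to \<open>F\<close>, without
  \<open>f\<close>: it consists of the elements of \<open>F\<close> for which \<open>f\<close> can be exchanged.  A minimal subset
  of \<open>F\<close> that spans \<open>f\<close> cannot contain any other element, by the exchange axiom.\<close>

lemma in_cl_fundamental_circuit:
  assumes "indep F" "f \<in> cl F"
  shows "f \<in> cl {g \<in> F. f \<notin> cl (F - {g})}"
proof -
  define S where "S = {A. A \<subseteq> F \<and> f \<in> cl A}"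
  have F: "F \<subseteq> E" using assms(1) by (rule indep_ground)
  have "finite S" using indep_finite[OF assms(1)] by (simp add: S_def)
  moreover have "F \<in> S" using assms(2) by (simp add: S_def)
  ultimately obtain A where "A \<in> S" and min: "\<And>C. C \<in> S \<Longrightarrow> C \<subseteq> A \<Longrightarrow> A = C"
    using finite_has_minimal2[of S F] by metis
  then have A: "A \<subseteq> F" "f \<in> cl A" by (simp_all add: S_def)
  have "f \<notin> cl (F - {g})" if g: "g \<in> A" for g
  proof
    assume f: "f \<in> cl (F - {g})"
    have "f \<notin> cl (A - {g})" using min[of "A - {g}"] A g by (auto simp: S_def)
    moreover have "f \<in> cl (insert g (A - {g}))" using A g by (simp add: insert_absorb)
    ultimately have "g \<in> cl (insert f (A - {g}))" using exchange A F g by blast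
    moreover have "insert f (A - {g}) \<subseteq> cl (F - {g})" using f A F extensive[of "F - {g}"] by blast
    ultimately have "g \<in> cl (F - {g})" using cl_least by blast
    then show False using assms(1) A g by (auto simp: indep_def)
  qed
  then have "A \<subseteq> {g \<in> F. f \<notin> cl (F - {g})}" using A by blast
  then have "cl A \<subseteq> cl {g \<in> F. f \<notin> cl (F - {g})}" using F by (intro cl_mono) auto
  then show ?thesis using A by blast
qed

lemma cl_swap:
  assumes "A \<subseteq> E" "g \<in> A" "f \<in> cl A" "f \<notin> cl (A - {g})"
  shows "cl (insert f (A - {g})) = cl A"
proof (rule antisym; rule cl_least)
  show "insert f (A - {g}) \<subseteq> cl A" using assms extensive by blast
  have "insert f (A - {g}) \<subseteq> E" using assms cl_ground by blast
  moreover have "g \<in> cl (insert f (A - {g}))"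
    using exchange[of g f "A - {g}"] assms by (auto simp: insert_absorb)
  ultimately show "A \<subseteq> cl (insert f (A - {g}))" using extensive by blast
qed

section \<open>Adding an element to a union of independent sets\<close>

text \<open>The situations that arise from \<open>k\<close> independent sets \<open>F\<^sub>0\<close> and a spare element \<open>e\<close> by
  repeatedly putting the spare element into one of the sets in exchange for an element of its
  fundamental circuit, which becomes the new spare element.\<close>

inductive exchange_reachable ::
    "nat \<Rightarrow> (nat \<Rightarrow> 'a set) \<Rightarrow> 'a \<Rightarrow> (nat \<Rightarrow> 'a set) \<Rightarrow> 'a \<Rightarrow> bool"
  for k F\<^sub>0 e where
  start: "exchange_reachable k F\<^sub>0 e F\<^sub>0 e"
| swap: "exchange_reachable k F\<^sub>0 e F f \<Longrightarrow> i < k \<Longrightarrow> g \<in> F i \<Longrightarrow> f \<notin> cl (F i - {g}) \<Longrightarrow>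
    exchange_reachable k F\<^sub>0 e (F(i := insert f (F i - {g}))) g"

lemma exchange_reachable_partition:
  assumes "exchange_reachable k F\<^sub>0 e F f"
    and "\<And>i. i < k \<Longrightarrow> indep (F\<^sub>0 i)" "e \<in> E" "e \<notin> (\<Union>i<k. F\<^sub>0 i)" "disjoint_family_on F\<^sub>0 {..<k}"
  shows "(\<forall>i<k. indep (F i)) \<and> f \<in> E \<and> f \<notin> (\<Union>i<k. F i) \<and> disjoint_family_on F {..<k} \<and>
    insert f (\<Union>i<k. F i) = insert e (\<Union>i<k. F\<^sub>0 i)"
  using assms(1)
proof induction
  case start
  then show ?case using assms by blast
next
  case (swap F f i g)
  let ?F = "F(i := insert f (F i - {g}))"
  have "indep (insert f (F i - {g}))"
    using swap indep_subset[of "F i" "F i - {g}"] by (intro indep_insert) auto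
  then have "\<forall>j<k. indep (?F j)" using swap.IH by simp
  moreover have "g \<in> E" using swap indep_ground by blast
  moreover have "g \<notin> ?F j" if "j < k" for j
  proof (cases "j = i")
    case True
    then show ?thesis using swap by auto
  next
    case False
    then have "F j \<inter> F i = {}" using swap that by (simp add: disjoint_family_on_def)
    then show ?thesis using False swap.hyps by auto
  qed
  then have "g \<notin> (\<Union>j<k. ?F j)" by blast
  moreover have "disjoint_family_on ?F {..<k}"
    unfolding disjoint_family_on_def
  proof (intro ballI impI)
    fix m n assume mn: "m \<in> {..<k}" "n \<in> {..<k}" "m \<noteq> n"
    then have "F m \<inter> F n = {}" "f \<notin> F m" "f \<notin> F n"
      using swap.IH unfolding disjoint_family_on_def by blast+
    then show "?F m \<inter> ?F n = {}" using mn(3) by auto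
  qed
  moreover have "insert g (\<Union>j<k. ?F j) = insert f (\<Union>j<k. F j)"
    using swap.hyps by (auto split: if_splits)
  then have "insert g (\<Union>j<k. ?F j) = insert e (\<Union>j<k. F\<^sub>0 j)" using swap.IH by simp
  ultimately show ?case by blast
qed

text \<open>The augmentation step behind the matroid partition theorem.  If the spare element can never
  be placed, let \<open>R\<close> be the set of all elements that become spare at some time.  Each of them
  is spanned by its fundamental circuit in every one of the current sets, and this circuit lies
  in \<open>R\<close>.  Exchanges therefore do not change the closure of \<open>F i \<inter> R\<close>, so that already the
  original \<open>F i \<inter> R\<close> span \<open>R\<close>, for every \<open>i\<close>.\<close>

lemma partition_augmentation:
  fixes k :: nat
  assumes indep: "\<And>i. i < k \<Longrightarrow> indep (F\<^sub>0 i)" and disj: "disjoint_family_on F\<^sub>0 {..<k}"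
    and e: "e \<in> E" "e \<notin> (\<Union>i<k. F\<^sub>0 i)"
    and stuck: "\<nexists>F. (\<forall>i<k. indep (F i)) \<and> (\<Union>i<k. F i) = insert e (\<Union>i<k. F\<^sub>0 i)"
  obtains X where "X \<subseteq> (\<Union>i<k. F\<^sub>0 i)" "\<And>i. i < k \<Longrightarrow> insert e X \<subseteq> cl (F\<^sub>0 i \<inter> X)"
proof -
  define R where "R = {f. \<exists>F. exchange_reachable k F\<^sub>0 e F f}"
  note part = exchange_reachable_partition[OF _ indep e disj]
  have spare_cl: "f \<in> cl (F i)" if "exchange_reachable k F\<^sub>0 e F f" "i < k" for F f i
  proof (rule ccontr)
    assume "f \<notin> cl (F i)"
    then have "\<forall>j<k. indep ((F(i := insert f (F i))) j)"
      using part[OF that(1)] that(2) indep_insert by simp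
    moreover have "(\<Union>j<k. (F(i := insert f (F i))) j) = insert f (\<Union>j<k. F j)"
      using that(2) by (auto split: if_splits)
    ultimately show False using stuck part[OF that(1)] by metis
  qed
  have spare_cl_R: "f \<in> cl (F i \<inter> R)" if "exchange_reachable k F\<^sub>0 e F f" "i < k" for F f i
  proof -
    let ?C = "{g \<in> F i. f \<notin> cl (F i - {g})}"
    have "?C \<subseteq> F i \<inter> R"
      using exchange_reachable.swap[OF that] unfolding R_def by blast
    moreover have "F i \<inter> R \<subseteq> E" using part[OF that(1)] that(2) indep_ground by blast
    ultimately have "cl ?C \<subseteq> cl (F i \<inter> R)" by (rule cl_mono)
    then show ?thesis
      using in_cl_fundamental_circuit[of "F i" f] part[OF that(1)] spare_cl[OF that] that(2) by blast
  qed
  have cl_R: "cl (F j \<inter> R) = cl (F\<^sub>0 j \<inter> R)" if "exchange_reachable k F\<^sub>0 e F f" "j < k" for F f j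
    using that(1)
  proof induction
    case (swap F f i g)
    show ?case
    proof (cases "j = i")
      case True
      have R: "f \<in> R" "g \<in> R"
        using swap.hyps exchange_reachable.swap unfolding R_def by blast+
      have f: "f \<notin> F i" and F: "F i \<subseteq> E"
        using part[OF swap.hyps(1)] swap.hyps(2) indep_ground by blast+
      have "f \<notin> cl (F i \<inter> R - {g})"
        using swap.hyps(4) cl_mono[of "F i \<inter> R - {g}" "F i - {g}"] F by blast
      then have "cl (insert f (F i \<inter> R - {g})) = cl (F i \<inter> R)"
        using spare_cl_R[OF swap.hyps(1,2)] swap.hyps(3) R F by (intro cl_swap) auto
      moreover have "insert f (F i - {g}) \<inter> R = insert f (F i \<inter> R - {g})"
        using R by blast
      ultimately show ?thesis using swap.IH True by simp
    next
      case False
      then show ?thesis using swap.IH by simp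
    qed
  qed simp
  let ?S = "\<Union>i<k. F\<^sub>0 i"
  have eR: "e \<in> R" using exchange_reachable.start unfolding R_def by blast
  have RS: "R \<subseteq> insert e ?S" using part unfolding R_def by blast
  show ?thesis
  proof (rule that[of "R - {e}"])
    show "R - {e} \<subseteq> ?S" using RS by blast
    show "insert e (R - {e}) \<subseteq> cl (F\<^sub>0 i \<inter> (R - {e}))" if "i < k" for i
    proof -
      have "F\<^sub>0 i \<inter> (R - {e}) = F\<^sub>0 i \<inter> R" using e(2) that by blast
      moreover have "R \<subseteq> cl (F\<^sub>0 i \<inter> R)"
        using spare_cl_R cl_R that unfolding R_def by blast
      ultimately show ?thesis using eR by auto
    qed
  qed
qed

end

section \<open>The graphic matroid\<close>

definition linked :: "('v, 'e) mgraph \<Rightarrow> 'e set \<Rightarrow> ('v \<times> 'v) set" where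
  "linked G A = (adjacent (G\<lparr>edges := A\<rparr>))\<^sup>*"

text \<open>The quantifier ranges over the two ways to name the ends of an edge.  They are equivalent, since
  the relation \<open>linked G A\<close> is symmetric.\<close>

definition spanned :: "('v, 'e) mgraph \<Rightarrow> 'e set \<Rightarrow> 'e set" where
  "spanned G A = {e \<in> edges G. \<forall>x y. ends G e = {x, y} \<longrightarrow> (x, y) \<in> linked G A}"

lemma adjacent_edges_update: "adjacent (G\<lparr>edges := A\<rparr>) = {(x, y). \<exists>e\<in>A. ends G e = {x, y}}"
  by (simp add: adjacent_def)

lemma linked_refl [simp]: "(x, x) \<in> linked G A"
  by (simp add: linked_def)

lemma linked_trans: "(x, y) \<in> linked G A \<Longrightarrow> (y, z) \<in> linked G A \<Longrightarrow> (x, z) \<in> linked G A"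
  unfolding linked_def by (rule rtrancl_trans)

lemma linked_sym:
  assumes "(x, y) \<in> linked G A"
  shows "(y, x) \<in> linked G A"
proof -
  have "sym (adjacent (G\<lparr>edges := A\<rparr>))"
    by (rule symI) (simp add: adjacent_edges_update insert_commute)
  then have "sym (linked G A)" unfolding linked_def by (rule sym_rtrancl)
  then show ?thesis using assms by (rule symD)
qed

lemma linked_edge: "e \<in> A \<Longrightarrow> ends G e = {x, y} \<Longrightarrow> (x, y) \<in> linked G A"
  unfolding linked_def by (rule r_into_rtrancl) (auto simp: adjacent_edges_update)

lemma linked_induct [consumes 1, case_names refl step]:
  assumes "(x, y) \<in> linked G A" "P x"
    and "\<And>y z e. (x, y) \<in> linked G A \<Longrightarrow> P y \<Longrightarrow> e \<in> A \<Longrightarrow> ends G e = {y, z} \<Longrightarrow> P z"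
  shows "P y"
  using assms(1) unfolding linked_def
proof induction
  case base
  then show ?case using assms(2) by blast
next
  case (step y z)
  then show ?case using assms(3) unfolding linked_def adjacent_edges_update by blast
qed

lemma linked_empty: "(x, y) \<in> linked G {} \<longleftrightarrow> x = y"
  by (auto simp: linked_def adjacent_edges_update)

lemma linked_least:
  assumes "\<And>e x y. e \<in> A \<Longrightarrow> ends G e = {x, y} \<Longrightarrow> (x, y) \<in> linked G B"
  shows "linked G A \<subseteq> linked G B"
proof (rule subrelI)
  fix x y assume "(x, y) \<in> linked G A"
  then show "(x, y) \<in> linked G B"
  proof (induction rule: linked_induct)
    case (step y z e)
    then show ?case using assms linked_trans[of x y G B z] by blast
  qed simp
qed

lemma linked_mono: "A \<subseteq> B \<Longrightarrow> linked G A \<subseteq> linked G B"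
  by (rule linked_least) (meson linked_edge subsetD)

lemma linked_if_spanned: "A \<subseteq> spanned G B \<Longrightarrow> linked G A \<subseteq> linked G B"
  by (rule linked_least) (auto simp: spanned_def)

lemma linked_insert:
  assumes "ends G e = {x, y}" "(a, b) \<in> linked G (insert e A)"
  shows "(a, b) \<in> linked G A \<or> (a, x) \<in> linked G A \<and> (y, b) \<in> linked G A \<or>
    (a, y) \<in> linked G A \<and> (x, b) \<in> linked G A"
  using assms(2)
proof (induction rule: linked_induct)
  case refl
  then show ?case by simp
next
  case (step b c d)
  show ?case
  proof (cases "d \<in> A")
    case True
    then show ?thesis using step linked_edge linked_trans by metis
  next
    case False
    then have "{b, c} = {x, y}" using step.hyps assms(1) by simp
    then consider "b = x" "c = y" | "b = y" "c = x" by (auto simp: doubleton_eq_iff)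
    then show ?thesis using step.IH by cases auto
  qed
qed

lemma connected_graph_linked:
  "connected_graph G \<longleftrightarrow> verts G \<noteq> {} \<and> (\<forall>u\<in>verts G. \<forall>v\<in>verts G. (u, v) \<in> linked G (edges G))"
  by (simp add: connected_graph_def linked_def)

lemma linked_edges_update [simp]: "linked (G\<lparr>edges := B\<rparr>) A = linked G A"
  by (simp add: linked_def)

text \<open>A walk that returns to one of its vertices is cut off at the first visit.\<close>

lemma distinct_path:
  assumes "(x, y) \<in> r\<^sup>*"
  shows "\<exists>p. p \<noteq> [] \<and> hd p = x \<and> last p = y \<and> distinct p \<and>
    successively (\<lambda>a b. (a, b) \<in> r) p"
  using assms
proof induction
  case base
  show ?case by (rule exI[of _ "[x]"]) auto
next
  case (step y z)
  obtain p where p: "p \<noteq> []" "hd p = x" "last p = y" "distinct p"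
    "successively (\<lambda>a b. (a, b) \<in> r) p"
    using step.IH by (elim exE conjE)
  show ?case
  proof (cases "z \<in> set p")
    case True
    then obtain ps qs where "p = ps @ z # qs" by (meson split_list)
    then show ?thesis
      using p by (intro exI[of _ "ps @ [z]"]) (auto simp: successively_append_iff hd_append)
  next
    case False
    then show ?thesis
      using p step.hyps by (intro exI[of _ "p @ [z]"]) (auto simp: successively_append_iff)
  qed
qed

context multigraph
begin

lemma spanned_iff:
  assumes "e \<in> edges G" "ends G e = {x, y}"
  shows "e \<in> spanned G A \<longleftrightarrow> (x, y) \<in> linked G A"
proof
  assume "(x, y) \<in> linked G A"
  moreover from this have "(y, x) \<in> linked G A" by (rule linked_sym)
  ultimately show "e \<in> spanned G A" using assms by (auto simp: spanned_def doubleton_eq_iff)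
qed (use assms in \<open>simp add: spanned_def\<close>)

lemma edge_ends:
  assumes "e \<in> edges G"
  obtains x y where "x \<in> verts G" "y \<in> verts G" "x \<noteq> y" "ends G e = {x, y}"
  using assms ends_edge by blast

sublocale closure_matroid "edges G" "spanned G"
proof
  show "finite (edges G)" by (rule finite_edges)
  show "spanned G A \<subseteq> edges G" for A by (auto simp: spanned_def)
  show "A \<subseteq> spanned G A" if "A \<subseteq> edges G" for A
    using that linked_edge[of _ A G] by (auto simp: spanned_def)
  show "spanned G A \<subseteq> spanned G B" if "A \<subseteq> spanned G B" for A B
    using linked_if_spanned[OF that] by (auto simp: spanned_def)
  show "g \<in> spanned G (insert f A)"
    if g: "g \<in> edges G" and f: "f \<in> spanned G (insert g A)" "f \<notin> spanned G A" for f g A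
  proof -
    have "f \<in> edges G" using f(1) by (simp add: spanned_def)
    then obtain a b where ab: "ends G f = {a, b}" and fE: "f \<in> edges G" by (meson edge_ends)
    obtain x y where xy: "ends G g = {x, y}" using g by (meson edge_ends)
    have "(a, x) \<in> linked G A \<and> (y, b) \<in> linked G A \<or>
        (a, y) \<in> linked G A \<and> (x, b) \<in> linked G A"
      using linked_insert[OF xy, of a b A] f spanned_iff[OF fE ab] by simp
    moreover have "linked G A \<subseteq> linked G (insert f A)" by (rule linked_mono) blast
    moreover have "(a, b) \<in> linked G (insert f A)" using linked_edge[OF _ ab] by simp
    ultimately have "(x, y) \<in> linked G (insert f A)"
      by (meson linked_sym linked_trans subsetD)
    then show ?thesis using spanned_iff[OF g xy] by simp
  qed
qed

text \<open>An edge whose ends are connected by the rest of \<open>F\<close> closes a path without repeated vertices to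
  a cycle; in a cycle, the other edges connect the ends of the last one.\<close>

lemma acyclic_edges_iff_indep:
  assumes "F \<subseteq> edges G"
  shows "acyclic_edges G F \<longleftrightarrow> indep F"
proof
  assume ac: "acyclic_edges G F"
  have "e \<notin> spanned G (F - {e})" if e: "e \<in> F" for e
  proof
    assume sp: "e \<in> spanned G (F - {e})"
    obtain x y where xy: "x \<noteq> y" "ends G e = {x, y}" using assms e by (meson edge_ends subsetD)
    then have "(x, y) \<in> linked G (F - {e})" using sp by (simp add: spanned_def)
    then obtain p where p: "p \<noteq> []" "hd p = x" "last p = y" "distinct p"
      and succ: "successively (\<lambda>a b. (a, b) \<in> adjacent (G\<lparr>edges := F - {e}\<rparr>)) p"
      using distinct_path unfolding linked_def by metis
    define n where "n = length p - 1"
    have len: "length p = Suc n" using p(1) by (simp add: n_def)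
    have p0: "p ! 0 = x" and pn: "p ! n = y"
      using p by (simp_all add: hd_conv_nth last_conv_nth n_def)
    then have n: "n > 0" using xy(1) by (cases n) auto
    have "\<exists>d. d \<in> F - {e} \<and> ends G d = {p ! i, p ! Suc i}" if "i < n" for i
      using succ that len unfolding successively_conv_nth adjacent_edges_update by auto
    then obtain d where d: "\<And>i. i < n \<Longrightarrow> d i \<in> F - {e} \<and> ends G (d i) = {p ! i, p ! Suc i}"
      by metis
    define es where "es = map d [0..<n] @ [e]"
    have "inj_on d {0..<n}"
    proof (rule inj_onI)
      fix i j assume ij: "i \<in> {0..<n}" "j \<in> {0..<n}" "d i = d j"
      then have "{p ! i, p ! Suc i} = {p ! j, p ! Suc j}" using d by (metis atLeastLessThan_iff)
      then show "i = j"
        using ij len nth_eq_iff_index_eq[OF p(4)] by (auto simp: doubleton_eq_iff)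
    qed
    moreover have dF: "d i \<in> F" "d i \<noteq> e" if "i < n" for i using d[OF that] by auto
    then have "e \<notin> d ` {0..<n}" by fastforce
    ultimately have "distinct es" by (simp add: es_def distinct_map)
    moreover have sub: "set es \<subseteq> F" using dF(1) e by (auto simp: es_def)
    moreover have "ends G (es ! i) = {p ! i, p ! (Suc i mod length p)}" if "i < length p" for i
    proof (cases "i < n")
      case True
      then show ?thesis using d len by (simp add: es_def nth_append)
    next
      case False
      then have "i = n" using that len by simp
      then show ?thesis using len xy p0 pn by (auto simp: es_def nth_append)
    qed
    ultimately have "is_cycle G p es"
      using p(4) len n assms by (auto simp: is_cycle_def es_def)
    then show False using ac sub by (auto simp: acyclic_edges_def)
  qed
  then show "indep F" using assms by (simp add: indep_def)
next
  assume ind: "indep F"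
  show "acyclic_edges G F"
    unfolding acyclic_edges_def
  proof (safe)
    fix vs es assume c: "is_cycle G vs es" and sub: "set es \<subseteq> F"
    then have "length vs \<ge> 2" by (simp add: is_cycle_def)
    then obtain n where n: "length vs = Suc n" "n > 0" by (cases "length vs") auto
    then have len: "length es = Suc n" and dist: "distinct es"
      and en: "\<And>i. i < Suc n \<Longrightarrow> ends G (es ! i) = {vs ! i, vs ! (Suc i mod Suc n)}"
      using c by (simp_all add: is_cycle_def)
    let ?e = "es ! n"
    have "(vs ! 0, vs ! i) \<in> linked G (F - {?e})" if "i \<le> n" for i
      using that
    proof (induction i)
      case (Suc i)
      have "es ! i \<in> F" using Suc.prems len sub nth_mem[of i es] by auto
      moreover have "es ! i \<noteq> ?e" using Suc.prems len nth_eq_iff_index_eq[OF dist] by simp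
      ultimately have "es ! i \<in> F - {?e}" by simp
      moreover have "ends G (es ! i) = {vs ! i, vs ! Suc i}" using en[of i] Suc.prems by simp
      ultimately have "(vs ! i, vs ! Suc i) \<in> linked G (F - {?e})" by (rule linked_edge)
      then show ?case using linked_trans Suc.IH Suc.prems by (meson Suc_leD)
    qed simp
    then have "(vs ! 0, vs ! n) \<in> linked G (F - {?e})" by simp
    then have "(vs ! n, vs ! 0) \<in> linked G (F - {?e})" by (rule linked_sym)
    moreover have eF: "?e \<in> F" using len sub nth_mem[of n es] by auto
    moreover have "ends G ?e = {vs ! n, vs ! 0}" using en[of n] by simp
    ultimately have "?e \<in> spanned G (F - {?e})" using spanned_iff[of ?e] assms by (meson subsetD)
    then show False using ind eF by (simp add: indep_def)
  qed
qed

lemma indep_singleton: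
  assumes "e \<in> edges G"
  shows "indep {e}"
proof -
  obtain x y where "x \<noteq> y" "ends G e = {x, y}" using assms by (meson edge_ends)
  then have "e \<notin> spanned G {}" using spanned_iff[OF assms] by (simp add: linked_empty)
  then show ?thesis using indep_insert[OF indep_empty] assms by simp
qed

lemma card_le_graphic_rank:
  assumes "indep I" "I \<subseteq> X" "X \<subseteq> edges G"
  shows "card I \<le> graphic_rank G X"
  unfolding graphic_rank_def
proof (rule Max_ge)
  have "finite X" using assms(3) finite_edges finite_subset by blast
  then show "finite (card ` {F. F \<subseteq> X \<and> acyclic_edges G F})" by simp
  show "card I \<in> card ` {F. F \<subseteq> X \<and> acyclic_edges G F}"
    using assms acyclic_edges_iff_indep by blast
qed

lemma graphic_rank_eq_card:
  assumes "indep B" "B \<subseteq> X" "X \<subseteq> spanned G B"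
  shows "graphic_rank G X = card B"
proof (rule antisym)
  have X: "X \<subseteq> edges G" using assms(3) cl_ground by blast
  show "card B \<le> graphic_rank G X" using card_le_graphic_rank assms X by blast
  show "graphic_rank G X \<le> card B"
    unfolding graphic_rank_def
  proof (rule Max.boundedI)
    have "finite X" using X finite_edges finite_subset by blast
    then show "finite (card ` {F. F \<subseteq> X \<and> acyclic_edges G F})" by simp
    have "acyclic_edges G B" using assms(1) acyclic_edges_iff_indep indep_ground by simp
    then show "card ` {F. F \<subseteq> X \<and> acyclic_edges G F} \<noteq> {}" using assms(2) by auto
    fix m assume "m \<in> card ` {F. F \<subseteq> X \<and> acyclic_edges G F}"
    then obtain F where F: "m = card F" "F \<subseteq> X" "acyclic_edges G F" by auto
    then have "indep F" using acyclic_edges_iff_indep X by (meson subset_trans)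
    moreover have "F \<subseteq> spanned G B" using F(2) assms(3) by (rule subset_trans)
    ultimately show "m \<le> card B"
      using F(1) card_indep_le indep_ground[OF assms(1)] by simp
  qed
qed

lemma spanning_tree_iff:
  "T \<in> spanning_trees G \<longleftrightarrow> indep T \<and> connected_graph (G\<lparr>edges := T\<rparr>)"
  using acyclic_edges_iff_indep[of T] indep_ground[of T] by (auto simp: spanning_trees_def)

lemma indep_extends_to_spanning_tree:
  assumes "connected_graph G" "indep F"
  obtains T where "T \<in> spanning_trees G" "F \<subseteq> T"
proof -
  obtain T where T: "F \<subseteq> T" "indep T" "edges G \<subseteq> spanned G T"
    by (rule basis_extension[OF assms(2) indep_ground[OF assms(2)] order_refl])
  have "linked G (edges G) \<subseteq> linked G T" using T(3) by (rule linked_if_spanned)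
  then have "connected_graph (G\<lparr>edges := T\<rparr>)"
    using assms(1) by (auto simp: connected_graph_linked)
  then show ?thesis using that[of T] T(1,2) spanning_tree_iff[of T] by simp
qed

lemma card_spanning_tree:
  assumes "T \<in> spanning_trees G"
  shows "card T = graphic_rank G (edges G)"
proof -
  have T: "indep T" "connected_graph (G\<lparr>edges := T\<rparr>)" using assms spanning_tree_iff by auto
  have "e \<in> spanned G T" if e: "e \<in> edges G" for e
  proof -
    obtain x y where xy: "x \<in> verts G" "y \<in> verts G" "ends G e = {x, y}" using e by (meson edge_ends)
    then have "(x, y) \<in> linked G T" using T(2) by (auto simp: connected_graph_linked)
    then show ?thesis using spanned_iff e xy by blast
  qed
  then have "edges G \<subseteq> spanned G T" by (rule subsetI)
  then show ?thesis using graphic_rank_eq_card[OF T(1) indep_ground[OF T(1)]] by simp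
qed

section \<open>Arboricity as a covering number by forests\<close>

lemma spanning_tree_cover_exists:
  assumes "connected_graph G"
  shows "\<exists>\<T>. finite \<T> \<and> card \<T> = arboricity G \<and> \<T> \<subseteq> spanning_trees G \<and> \<Union>\<T> = edges G"
  unfolding arboricity_def
proof (rule LeastI_ex)
  have fin: "finite (spanning_trees G)"
    by (rule finite_subset[of _ "Pow (edges G)"]) (auto simp: spanning_trees_def finite_edges)
  have "e \<in> \<Union>(spanning_trees G)" if "e \<in> edges G" for e
    using indep_extends_to_spanning_tree[OF assms indep_singleton[OF that]] by blast
  then have "\<Union>(spanning_trees G) = edges G" by (auto simp: spanning_trees_def)
  then show "\<exists>n \<T>. finite \<T> \<and> card \<T> = n \<and> \<T> \<subseteq> spanning_trees G \<and> \<Union>\<T> = edges G"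
    using fin by blast
qed

text \<open>Covers by forests need not consist of distinct or spanning members, so they restrict to
  subgraphs and can be padded; extending each forest to a spanning tree returns to the definition
  of arboricity.\<close>

lemma arboricity_le_iff:
  assumes "connected_graph G"
  shows "arboricity G \<le> k \<longleftrightarrow> (\<exists>F. (\<forall>i<k. indep (F i)) \<and> (\<Union>i<k. F i) = edges G)"
proof
  assume k: "arboricity G \<le> k"
  obtain \<T> where T: "finite \<T>" "card \<T> = arboricity G" "\<T> \<subseteq> spanning_trees G" "\<Union>\<T> = edges G"
    using spanning_tree_cover_exists[OF assms] by (elim exE conjE)
  obtain h where h: "bij_betw h {..<card \<T>} \<T>"
    using bij_betw_from_nat_into_finite[OF T(1)] ..
  define F where "F i = (if i < card \<T> then h i else {})" for i
  have ind: "indep (F i)" for i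
    using bij_betwE[OF h] T(3) spanning_tree_iff indep_empty unfolding F_def by auto
  have img: "h ` {..<card \<T>} = \<T>" using h by (simp add: bij_betw_def)
  have "(\<Union>i<k. F i) = (\<Union>i<card \<T>. h i)"
    using k T(2) by (fastforce simp: F_def split: if_splits)
  then have "(\<Union>i<k. F i) = edges G" using T(4) img by simp
  then show "\<exists>F. (\<forall>i<k. indep (F i)) \<and> (\<Union>i<k. F i) = edges G" using ind by blast
next
  assume "\<exists>F. (\<forall>i<k. indep (F i)) \<and> (\<Union>i<k. F i) = edges G"
  then obtain F where F: "\<And>i. i < k \<Longrightarrow> indep (F i)" "(\<Union>i<k. F i) = edges G" by auto
  have "\<forall>i. \<exists>T. i < k \<longrightarrow> T \<in> spanning_trees G \<and> F i \<subseteq> T"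
    using indep_extends_to_spanning_tree[OF assms F(1)] by metis
  then obtain T where T: "\<And>i. i < k \<Longrightarrow> T i \<in> spanning_trees G \<and> F i \<subseteq> T i" by metis
  let ?T = "T ` {..<k}"
  have "?T \<subseteq> spanning_trees G" using T by auto
  moreover from this have "\<Union>?T \<subseteq> edges G" by (auto simp: spanning_trees_def)
  moreover have "edges G \<subseteq> \<Union>?T" unfolding F(2)[symmetric] using T by fastforce
  ultimately have "\<exists>\<T>. finite \<T> \<and> card \<T> = card ?T \<and> \<T> \<subseteq> spanning_trees G \<and> \<Union>\<T> = edges G"
    by (intro exI[of _ ?T]) auto
  then have "arboricity G \<le> card ?T" unfolding arboricity_def by (rule Least_le)
  also have "\<dots> \<le> k" using card_image_le[of "{..<k}" T] by simp
  finally show "arboricity G \<le> k" .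
qed

text \<open>The easy half of the theorem of Nash-Williams.\<close>

lemma card_le_arboricity_mult_rank:
  assumes "connected_graph G" "arboricity G \<le> k" "X \<subseteq> edges G"
  shows "card X \<le> k * graphic_rank G X"
proof -
  obtain F where F: "\<And>i. i < k \<Longrightarrow> indep (F i)" "(\<Union>i<k. F i) = edges G"
    using assms(2) arboricity_le_iff[OF assms(1)] by auto
  have "X = (\<Union>i<k. F i \<inter> X)" using F(2) assms(3) by blast
  then have "card X \<le> (\<Sum>i<k. card (F i \<inter> X))" using card_UN_le[of "{..<k}"] by (metis finite_lessThan)
  also have "\<dots> \<le> (\<Sum>i<k. graphic_rank G X)"
    using F(1) indep_subset assms(3)
    by (intro sum_mono card_le_graphic_rank) (meson Int_lower1 lessThan_iff, auto)
  finally show ?thesis by simp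
qed

section \<open>Fractional arboricity and homogeneous graphs\<close>

lemma finite_densities:
  "finite {real (card X) / real (graphic_rank G X) | X. X \<subseteq> edges G \<and> graphic_rank G X > 0}"
  using finite_edges by simp

lemma density_le_fractional_arboricity:
  assumes "X \<subseteq> edges G" "graphic_rank G X > 0"
  shows "real (card X) / real (graphic_rank G X) \<le> fractional_arboricity G"
  unfolding fractional_arboricity_def
  by (rule Max_ge[OF finite_densities]) (use assms in auto)

lemma fractional_arboricity_attained:
  assumes "edges G \<noteq> {}"
  obtains X where "X \<subseteq> edges G" "graphic_rank G X > 0"
    "fractional_arboricity G = real (card X) / real (graphic_rank G X)"
proof -
  obtain e where e: "e \<in> edges G" using assms by auto
  then have "graphic_rank G {e} > 0"
    using card_le_graphic_rank[OF indep_singleton[OF e], of "{e}"] by simp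
  then have "{real (card X) / real (graphic_rank G X) | X. X \<subseteq> edges G \<and> graphic_rank G X > 0} \<noteq> {}"
    using e by auto
  then have "fractional_arboricity G \<in>
      {real (card X) / real (graphic_rank G X) | X. X \<subseteq> edges G \<and> graphic_rank G X > 0}"
    unfolding fractional_arboricity_def by (rule Max_in[OF finite_densities])
  then show ?thesis using that by auto
qed

lemma sum_indicat_real: "finite X \<Longrightarrow> sum (indicat_real T) X = real (card (T \<inter> X))"
  by (simp add: indicator_def sum.If_cases Int_commute)

text \<open>A linear condition on the polytope only needs to be checked at the spanning trees, where it is
  a bound on the size of a forest.\<close>

lemma spanning_tree_polytope_sum_le_rank:
  assumes "\<eta> \<in> spanning_tree_polytope G" "X \<subseteq> edges G"
  shows "sum \<eta> X \<le> real (graphic_rank G X)"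
proof -
  have fin: "finite X" using assms(2) finite_edges by (rule finite_subset)
  have "spanning_tree_polytope G \<subseteq> {\<eta>. sum \<eta> X \<le> real (graphic_rank G X)}"
    unfolding spanning_tree_polytope_def
  proof (rule hull_minimal)
    show "indicat_real ` spanning_trees G \<subseteq> {\<eta>. sum \<eta> X \<le> real (graphic_rank G X)}"
    proof (rule image_subsetI, rule CollectI)
      fix T assume "T \<in> spanning_trees G"
      then have "indep (T \<inter> X)" using spanning_tree_iff indep_subset by (meson Int_lower1)
      then have "card (T \<inter> X) \<le> graphic_rank G X" using assms(2) by (intro card_le_graphic_rank) auto
      then show "sum (indicat_real T) X \<le> real (graphic_rank G X)"
        by (simp add: sum_indicat_real[OF fin])
    qed
    show "convex {\<eta>. sum \<eta> X \<le> real (graphic_rank G X)}"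
      by (auto simp: convex_def sum.distrib sum_distrib_left[symmetric] intro: convex_bound_le)
  qed
  then show ?thesis using assms(1) by auto
qed

lemma spanning_tree_polytope_sum_edges:
  assumes "\<eta> \<in> spanning_tree_polytope G"
  shows "sum \<eta> (edges G) = real (graphic_rank G (edges G))"
proof -
  have "spanning_tree_polytope G \<subseteq> {\<eta>. sum \<eta> (edges G) = real (graphic_rank G (edges G))}"
    unfolding spanning_tree_polytope_def
  proof (rule hull_minimal)
    show "indicat_real ` spanning_trees G \<subseteq> {\<eta>. sum \<eta> (edges G) = real (graphic_rank G (edges G))}"
    proof (rule image_subsetI, rule CollectI)
      fix T assume T: "T \<in> spanning_trees G"
      then have "T \<inter> edges G = T" by (auto simp: spanning_trees_def)
      then show "sum (indicat_real T) (edges G) = real (graphic_rank G (edges G))"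
        using card_spanning_tree[OF T] by (simp add: sum_indicat_real[OF finite_edges])
    qed
    show "convex {\<eta>. sum \<eta> (edges G) = real (graphic_rank G (edges G))}"
      by (auto simp: convex_def sum.distrib sum_distrib_left[symmetric] distrib_right[symmetric])
  qed
  then show ?thesis using assms by auto
qed

text \<open>A constant vector \<open>c\<close> in the polytope has \<open>c |E| = r(E)\<close> and \<open>c |X| \<le> r(X)\<close> for every \<open>X\<close>,
  so no set of edges is denser than \<open>E\<close>.\<close>

lemma homogeneous_densest:
  assumes "homogeneous G" "edges G \<noteq> {}"
  shows "optimizes G G"
proof -
  obtain \<eta> c where mem: "\<eta> \<in> spanning_tree_polytope G" and c: "\<And>e. e \<in> edges G \<Longrightarrow> \<eta> e = c"
    using assms(1) by (auto simp: homogeneous_def min_norm_vector_def is_arg_min_def)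
  have sum: "sum \<eta> X = c * real (card X)" if "X \<subseteq> edges G" for X
  proof -
    have "sum \<eta> X = sum (\<lambda>_. c) X" using c that by (intro sum.cong) auto
    then show ?thesis by simp
  qed
  obtain X where X: "X \<subseteq> edges G" "graphic_rank G X > 0"
    and D: "fractional_arboricity G = real (card X) / real (graphic_rank G X)"
    using fractional_arboricity_attained[OF assms(2)] .
  obtain B where B: "B \<subseteq> X" "indep B" "X \<subseteq> spanned G B"
    using basis_extension[OF indep_empty empty_subsetI X(1)] by auto
  have "graphic_rank G X = card B" using graphic_rank_eq_card[OF B(2,1,3)] .
  also have "\<dots> \<le> graphic_rank G (edges G)"
    using B(1) X(1) by (intro card_le_graphic_rank[OF B(2)]) auto
  finally have r: "graphic_rank G (edges G) > 0" using X(2) by simp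
  have E: "c * real (card (edges G)) = real (graphic_rank G (edges G))"
    using spanning_tree_polytope_sum_edges[OF mem] sum by simp
  then have "c * real (card (edges G)) > 0" using r by simp
  then have c: "c > 0" by (simp add: zero_less_mult_iff)
  have "c * real (card X) \<le> real (graphic_rank G X)"
    using spanning_tree_polytope_sum_le_rank[OF mem X(1)] sum[OF X(1)] by simp
  then have "fractional_arboricity G \<le> 1 / c"
    using c X(2) by (simp add: D field_simps)
  also have "1 / c = real (card (edges G)) / real (graphic_rank G (edges G))"
    using c r E by (simp add: field_simps)
  finally show ?thesis
    using density_le_fractional_arboricity[OF order_refl r] r by (simp add: optimizes_def)
qed

section \<open>Adding an edge\<close>

lemma multigraph_add_edge:
  assumes "u \<in> verts G" "v \<in> verts G" "u \<noteq> v"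
  shows "multigraph (add_edge G u v)"
proof
  show "finite (verts (add_edge G u v))" using finite_verts by (simp add: add_edge_def)
  show "finite (edges (add_edge G u v))" using finite_edges by (simp add: add_edge_def)
  fix x assume "x \<in> edges (add_edge G u v)"
  then show "\<exists>a\<in>verts (add_edge G u v). \<exists>b\<in>verts (add_edge G u v).
      a \<noteq> b \<and> ends (add_edge G u v) x = {a, b}"
    using assms ends_edge by (cases x) (auto simp: add_edge_def)
qed

end

lemma edges_add_edge: "edges (add_edge G u v) = insert None (Some ` edges G)"
  by (simp add: add_edge_def)

lemma linked_add_edge: "linked (add_edge G u v) (Some ` A) = linked G A"
  by (simp add: linked_def adjacent_def add_edge_def)

lemma connected_add_edge:
  assumes "connected_graph G"
  shows "connected_graph (add_edge G u v)"
proof -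
  have "linked G (edges G) \<subseteq> linked (add_edge G u v) (edges (add_edge G u v))"
    unfolding linked_add_edge[of G u v, symmetric] edges_add_edge by (rule linked_mono) auto
  moreover have "verts (add_edge G u v) = verts G" by (simp add: add_edge_def)
  ultimately show ?thesis using assms by (auto simp: connected_graph_linked)
qed

lemma edges_induced_subgraph: "edges (induced_subgraph G W) = {e \<in> edges G. ends G e \<subseteq> W}"
  by (simp add: induced_subgraph_def)

lemma connected_induced_subgraph_iff:
  "connected_graph (induced_subgraph G W) \<longleftrightarrow>
    W \<noteq> {} \<and> (\<forall>x\<in>W. \<forall>y\<in>W. (x, y) \<in> linked G (edges (induced_subgraph G W)))"
  by (simp add: connected_graph_def linked_def adjacent_def induced_subgraph_def)

text \<open>The edges of the extended graph are the new edge \<open>None\<close> and the edges \<open>Some e\<close> for \<open>e\<close> in \<open>G\<close>, so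
  the matroid of \<open>G\<close> appears in it under \<open>Some\<close>.\<close>

locale added_edge = multigraph G for G :: "('v, 'e) mgraph" +
  fixes u v :: 'v
  assumes uv: "u \<in> verts G" "v \<in> verts G" "u \<noteq> v"
    and connected: "connected_graph G"
begin

sublocale H: multigraph "add_edge G u v"
  using uv by (rule multigraph_add_edge)

lemma None_in_spanned_iff: "None \<in> spanned (add_edge G u v) (Some ` A) \<longleftrightarrow> (u, v) \<in> linked G A"
proof -
  have "None \<in> edges (add_edge G u v)" "ends (add_edge G u v) None = {u, v}"
    by (simp_all add: add_edge_def)
  then show ?thesis by (simp add: H.spanned_iff linked_add_edge)
qed

lemma Some_in_spanned_iff: "Some e \<in> spanned (add_edge G u v) (Some ` A) \<longleftrightarrow> e \<in> spanned G A"
  unfolding spanned_def linked_add_edge by (auto simp: add_edge_def)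

lemma indep_Some_iff: "H.indep (Some ` A) \<longleftrightarrow> indep A"
proof -
  have "Some ` A - {Some a} = Some ` (A - {a})" for a by auto
  moreover have "Some ` A \<subseteq> edges (add_edge G u v) \<longleftrightarrow> A \<subseteq> edges G"
    by (auto simp: edges_add_edge)
  ultimately show ?thesis by (simp add: H.indep_def indep_def Some_in_spanned_iff)
qed

lemma arboricity_le_add_edge: "arboricity G \<le> arboricity (add_edge G u v)"
proof -
  obtain F where F: "\<And>i. i < arboricity (add_edge G u v) \<Longrightarrow> H.indep (F i)"
    "(\<Union>i<arboricity (add_edge G u v). F i) = edges (add_edge G u v)"
    using H.arboricity_le_iff[OF connected_add_edge[OF connected],
        of "arboricity (add_edge G u v)"] by auto
  have "indep (Some -` F i)" if "i < arboricity (add_edge G u v)" for i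
    unfolding indep_Some_iff[symmetric] using F(1)[OF that] by (rule H.indep_subset) auto
  moreover have "(\<Union>i<arboricity (add_edge G u v). Some -` F i) = edges G"
    unfolding vimage_UN[symmetric] F(2) by (auto simp: edges_add_edge)
  ultimately show ?thesis unfolding arboricity_le_iff[OF connected] by (intro exI conjI) auto
qed

text \<open>A set of edges that spans \<open>u\<close> and \<open>v\<close> and has the greatest size \<open>k r\<close> that \<open>k\<close> forests can cover
  becomes too large when the new edge is added to it, since its rank does not grow.\<close>

lemma tight_subgraph_blocks:
  assumes W: "u \<in> W" "v \<in> W" "connected_graph (induced_subgraph G W)"
    and tight: "card (edges (induced_subgraph G W)) = k * graphic_rank G (edges (induced_subgraph G W))"
  shows "\<not> arboricity (add_edge G u v) \<le> k"
proof
  assume ar: "arboricity (add_edge G u v) \<le> k"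
  let ?E = "edges (induced_subgraph G W)"
  have EG: "?E \<subseteq> edges G" by (auto simp: edges_induced_subgraph)
  obtain B where B: "B \<subseteq> ?E" "indep B" "?E \<subseteq> spanned G B"
    using basis_extension[OF indep_empty empty_subsetI EG] by auto
  have "(u, v) \<in> linked G ?E" using W by (simp add: connected_induced_subgraph_iff)
  then have "(u, v) \<in> linked G B" using linked_if_spanned[OF B(3)] by auto
  then have "insert None (Some ` ?E) \<subseteq> spanned (add_edge G u v) (Some ` B)"
    using B(3) None_in_spanned_iff Some_in_spanned_iff by auto
  then have "graphic_rank (add_edge G u v) (insert None (Some ` ?E)) = card (Some ` B)"
    using B(1,2) by (intro H.graphic_rank_eq_card) (auto simp: indep_Some_iff)
  also have "\<dots> = graphic_rank G ?E"
    using graphic_rank_eq_card[OF B(2,1,3)] by (simp add: card_image)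
  finally have "card (insert None (Some ` ?E)) \<le> k * graphic_rank G ?E"
    using H.card_le_arboricity_mult_rank[OF connected_add_edge[OF connected] ar,
        of "insert None (Some ` ?E)"] EG
    by (auto simp: edges_add_edge)
  moreover have "card (insert None (Some ` ?E)) = Suc (card ?E)"
    using finite_subset[OF EG finite_edges] by (subst card_insert_disjoint) (auto simp: card_image)
  ultimately show False using tight by simp
qed

text \<open>Conversely, if \<open>k\<close> forests cover \<open>G\<close> but not \<open>G + uv\<close>, augmentation yields a set \<open>Y\<close> of edges
  that each of the forests, restricted to \<open>Y\<close>, spans together with the new edge.  The component \<open>W\<close>
  of \<open>u\<close> in \<open>Y\<close> contains \<open>v\<close>, and every forest restricted to \<open>Y\<close> and \<open>W\<close> is a spanning tree
  of \<open>W\<close>.  The \<open>k\<close> restrictions are disjoint, so they fill the subgraph induced on \<open>W\<close>.\<close>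

lemma blocked_by_tight_subgraph:
  assumes ar: "arboricity G \<le> k" and k: "k > 0" and blocked: "\<not> arboricity (add_edge G u v) \<le> k"
  obtains W where "W \<subseteq> verts G" "u \<in> W" "v \<in> W" "connected_graph (induced_subgraph G W)"
    "graphic_rank G (edges (induced_subgraph G W)) > 0"
    "card (edges (induced_subgraph G W)) = k * graphic_rank G (edges (induced_subgraph G W))"
proof -
  obtain C where C: "\<And>i. i < k \<Longrightarrow> indep (C i)" "(\<Union>i<k. C i) = edges G"
    using ar arboricity_le_iff[OF connected] by auto
  define F where "F = disjointed C"
  have F: "indep (F i)" if "i < k" for i
    using indep_subset[OF C(1)[OF that]] disjointed_subset[of C i] by (simp add: F_def)
  have disj: "disjoint_family F" unfolding F_def by (rule disjoint_family_disjointed)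
  have cover: "(\<Union>i<k. F i) = edges G"
    using finite_UN_disjointed_eq[of C k] C(2) by (simp add: F_def atLeast0LessThan)
  have cover_Some: "(\<Union>i<k. Some ` F i) = Some ` edges G"
    unfolding image_UN[symmetric] cover ..
  have indep_Some: "H.indep (Some ` F i)" if "i < k" for i
    using F[OF that] by (simp add: indep_Some_iff)
  have disj_Some: "disjoint_family_on (\<lambda>i. Some ` F i) {..<k}"
    using disj unfolding disjoint_family_on_def by fastforce
  have None_new: "None \<in> edges (add_edge G u v)" "None \<notin> (\<Union>i<k. Some ` F i)"
    by (auto simp: edges_add_edge)
  have stuck: "\<nexists>F'. (\<forall>i<k. H.indep (F' i)) \<and> (\<Union>i<k. F' i) = insert None (\<Union>i<k. Some ` F i)"
    using blocked H.arboricity_le_iff[OF connected_add_edge[OF connected], of k]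
    unfolding cover_Some edges_add_edge by simp
  obtain X where X: "X \<subseteq> (\<Union>i<k. Some ` F i)"
    "\<And>i. i < k \<Longrightarrow> insert None X \<subseteq> spanned (add_edge G u v) (Some ` F i \<inter> X)"
    using H.partition_augmentation[OF indep_Some disj_Some None_new stuck] by metis
  define Y where "Y = Some -` X"
  have XY: "X = Some ` Y" using X(1) by (auto simp: Y_def)
  have "Some ` Y \<subseteq> Some ` edges G" using X(1) unfolding cover_Some XY .
  then have YG: "Y \<subseteq> edges G" by auto
  have sp: "Y \<subseteq> spanned G (F i \<inter> Y)" and uvF: "(u, v) \<in> linked G (F i \<inter> Y)" if "i < k" for i
  proof -
    have "Some ` F i \<inter> X = Some ` (F i \<inter> Y)" by (auto simp: XY)
    then have "insert None (Some ` Y) \<subseteq> spanned (add_edge G u v) (Some ` (F i \<inter> Y))"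
      using X(2)[OF that] XY by simp
    then show "Y \<subseteq> spanned G (F i \<inter> Y)" "(u, v) \<in> linked G (F i \<inter> Y)"
      using None_in_spanned_iff Some_in_spanned_iff by auto
  qed
  \<comment> \<open>The set \<open>Y\<close> itself may have several components; only the one of \<open>u\<close> matters.\<close>
  define W where "W = {w \<in> verts G. (u, w) \<in> linked G Y}"
  let ?E = "edges (induced_subgraph G W)"
  have EG: "?E \<subseteq> edges G" by (auto simp: edges_induced_subgraph)
  have uW: "u \<in> W" using uv by (simp add: W_def)
  have "linked G (F 0 \<inter> Y) \<subseteq> linked G Y" by (rule linked_mono) auto
  then have vW: "v \<in> W" using uv uvF[OF k] by (auto simp: W_def)
  define B where "B i = F i \<inter> Y \<inter> ?E" for i
  have from_u: "w \<in> W \<and> (u, w) \<in> linked G (B i)" if "(u, w) \<in> linked G (F i \<inter> Y)" for i w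
    using that
  proof (induction rule: linked_induct)
    case refl
    then show ?case using uW by simp
  next
    case (step y z e)
    have eG: "e \<in> edges G" using step.hyps YG by auto
    have "(u, y) \<in> linked G Y" using step.IH by (simp add: W_def)
    moreover have "(y, z) \<in> linked G Y" using linked_edge[of e Y] step.hyps by simp
    ultimately have "(u, z) \<in> linked G Y" by (rule linked_trans)
    moreover have "z \<in> verts G" using ends_edge[OF eG] step.hyps(3) by (auto simp: doubleton_eq_iff)
    ultimately have z: "z \<in> W" by (simp add: W_def)
    then have "e \<in> B i" using step eG by (simp add: B_def edges_induced_subgraph)
    then have "(y, z) \<in> linked G (B i)" using step.hyps(3) by (rule linked_edge)
    then show ?case using step.IH z linked_trans by metis
  qed
  have link: "(x, y) \<in> linked G (B i)" if i: "i < k" and xy: "x \<in> W" "y \<in> W" for i x y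
  proof -
    have "linked G Y \<subseteq> linked G (F i \<inter> Y)" using sp[OF i] by (rule linked_if_spanned)
    then have "(u, x) \<in> linked G (B i)" "(u, y) \<in> linked G (B i)"
      using xy from_u by (auto simp: W_def)
    then show ?thesis using linked_sym linked_trans by metis
  qed
  have rank: "graphic_rank G ?E = card (B i)" if i: "i < k" for i
  proof (rule graphic_rank_eq_card)
    show "indep (B i)" using F[OF i] by (rule indep_subset) (auto simp: B_def)
    show "B i \<subseteq> ?E" by (auto simp: B_def)
    show "?E \<subseteq> spanned G (B i)"
      using link[OF i] by (auto simp: spanned_def edges_induced_subgraph)
  qed
  have "linked G (B 0) \<subseteq> linked G ?E" by (rule linked_mono) (auto simp: B_def)
  then have conn: "connected_graph (induced_subgraph G W)"
    using link[OF k] uW unfolding connected_induced_subgraph_iff by auto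
  have "B 0 \<noteq> {}" using link[OF k uW vW] uv(3) linked_empty by metis
  moreover have "finite (B i)" for i
    using finite_subset[OF EG finite_edges] by (simp add: B_def)
  ultimately have pos: "graphic_rank G ?E > 0" using rank[OF k] by (simp add: card_gt_0_iff)
  have "k * graphic_rank G ?E = (\<Sum>i<k. graphic_rank G ?E)" by simp
  also have "\<dots> = (\<Sum>i<k. card (B i))" by (rule sum.cong) (simp_all only: lessThan_iff rank)
  also have "\<dots> = card (\<Union>i<k. B i)"
    using disj \<open>\<And>i. finite (B i)\<close>
    by (intro card_UN_disjoint[symmetric]) (auto simp: B_def disjoint_family_on_def)
  also have "\<dots> \<le> card ?E"
    using finite_subset[OF EG finite_edges] by (intro card_mono) (auto simp: B_def)
  finally have "card ?E = k * graphic_rank G ?E"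
    using card_le_arboricity_mult_rank[OF connected ar EG] by simp
  then show ?thesis using that[of W] uW vW conn pos by (auto simp: W_def)
qed

text \<open>Since a new edge cannot lower the arboricity, only the bound from above is in question, and the
  two preceding lemmas decide it.\<close>

theorem arboricity_add_edge_eq_iff:
  assumes "arboricity G = k" "k > 0"
  shows "arboricity (add_edge G u v) = k \<longleftrightarrow>
    \<not> (\<exists>W\<subseteq>verts G. u \<in> W \<and> v \<in> W \<and> connected_graph (induced_subgraph G W) \<and>
      graphic_rank G (edges (induced_subgraph G W)) > 0 \<and>
      card (edges (induced_subgraph G W)) = k * graphic_rank G (edges (induced_subgraph G W)))"
    (is "_ \<longleftrightarrow> \<not> ?blocked")
proof -
  have "arboricity (add_edge G u v) = k \<longleftrightarrow> arboricity (add_edge G u v) \<le> k"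
    using arboricity_le_add_edge assms(1) by auto
  moreover have "?blocked" if "\<not> arboricity (add_edge G u v) \<le> k"
  proof -
    have "arboricity G \<le> k" using assms(1) by simp
    from blocked_by_tight_subgraph[OF this assms(2) that] show ?thesis by metis
  qed
  moreover have "\<not> arboricity (add_edge G u v) \<le> k" if ?blocked
    using that tight_subgraph_blocks by metis
  ultimately show ?thesis by metis
qed

end

section \<open>The edges that can be added\<close>

theorem theorem7p7:
  fixes G :: "('v, 'e) mgraph" and k :: nat
  assumes "multigraph G" and "connected_graph G"
    and "arboricity G = k" and "k \<ge> 2"
  shows
    "(fractional_arboricity G < real k \<longrightarrow>
        addable_edges k G = {{v\<^sub>1, v\<^sub>2} | v\<^sub>1 v\<^sub>2. v\<^sub>1 \<in> verts G \<and> v\<^sub>2 \<in> verts G \<and> v\<^sub>1 \<noteq> v\<^sub>2})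
     \<and> (fractional_arboricity G = real k \<and> homogeneous G \<longrightarrow>
        addable_edges k G = {})
     \<and> (fractional_arboricity G = real k \<and> \<not> homogeneous G \<longrightarrow>
        addable_edges k G =
          {{v\<^sub>1, v\<^sub>2} | v\<^sub>1 v\<^sub>2. v\<^sub>1 \<in> verts G \<and> v\<^sub>2 \<in> verts G \<and> v\<^sub>1 \<noteq> v\<^sub>2 \<and>
             \<not> (\<exists>W \<subseteq> verts G. v\<^sub>1 \<in> W \<and> v\<^sub>2 \<in> W \<and>
                   connected_graph (induced_subgraph G W) \<and>
                   optimizes G (induced_subgraph G W))})"
proof -
  interpret multigraph G by (rule assms(1))
  have E: "edges G \<noteq> {}"
    using arboricity_le_iff[OF assms(2), of 0] assms(3,4) by auto
  let ?D = "fractional_arboricity G"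
  let ?tight = "\<lambda>W. graphic_rank G (edges (induced_subgraph G W)) > 0 \<and>
    card (edges (induced_subgraph G W)) = k * graphic_rank G (edges (induced_subgraph G W))"
  let ?blocked = "\<lambda>a b. \<exists>W\<subseteq>verts G. a \<in> W \<and> b \<in> W \<and>
    connected_graph (induced_subgraph G W) \<and> ?tight W"
  have addable: "addable_edges k G =
    {{a, b} | a b. a \<in> verts G \<and> b \<in> verts G \<and> a \<noteq> b \<and> \<not> ?blocked a b}"
  proof -
    have "arboricity (add_edge G a b) = k \<longleftrightarrow> \<not> ?blocked a b"
      if "a \<in> verts G" "b \<in> verts G" "a \<noteq> b" for a b
    proof -
      interpret added_edge G a b by unfold_locales (use that assms(2) in auto)
      show ?thesis using arboricity_add_edge_eq_iff[OF assms(3)] assms(4) by simp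
    qed
    then show ?thesis unfolding addable_edges_def by blast
  qed
  have tight_dense: "real k \<le> ?D" if "?tight W" for W
  proof -
    have "edges (induced_subgraph G W) \<subseteq> edges G" by (auto simp: edges_induced_subgraph)
    from density_le_fractional_arboricity[OF this] that show ?thesis by simp
  qed
  have tight_iff: "?tight W \<longleftrightarrow> optimizes G (induced_subgraph G W)" if "?D = real k" for W
    unfolding optimizes_def that
    by (auto simp: field_simps simp flip: of_nat_mult)
  have "addable_edges k G = {{a, b} | a b. a \<in> verts G \<and> b \<in> verts G \<and> a \<noteq> b}" if "?D < real k"
  proof -
    have "\<not> ?blocked a b" for a b using tight_dense that by fastforce
    then show ?thesis unfolding addable by simp
  qed
  moreover have "addable_edges k G = {}" if D: "?D = real k" and hom: "homogeneous G"
  proof -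
    have G: "induced_subgraph G (verts G) = G"
    proof -
      have "{e \<in> edges G. ends G e \<subseteq> verts G} = edges G" using ends_edge by fastforce
      then show ?thesis by (simp add: induced_subgraph_def)
    qed
    have "?tight (verts G)"
      using homogeneous_densest[OF hom E] tight_iff[OF D, of "verts G"] by (simp add: G)
    then have "?blocked a b" if "a \<in> verts G" "b \<in> verts G" for a b
      using that assms(2) by (intro exI[of _ "verts G"]) (simp add: G)
    then show ?thesis unfolding addable by blast
  qed
  moreover have "addable_edges k G =
      {{a, b} | a b. a \<in> verts G \<and> b \<in> verts G \<and> a \<noteq> b \<and>
        \<not> (\<exists>W\<subseteq>verts G. a \<in> W \<and> b \<in> W \<and> connected_graph (induced_subgraph G W) \<and>
          optimizes G (induced_subgraph G W))}" if "?D = real k"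
    unfolding addable tight_iff[OF that] ..
  ultimately show ?thesis by simp
qed

end
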